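(* Let $0<a<1$ and $\phi_a(z)=az+(1-a)$. Let $f\in H^2$ be non-zero and analytic at the point $1$. Then $K_f$ is a minimal invariant subspace for $C_{\phi_a}$ if and only if $f$ is a scalar multiple of $f_N(z)=(1-z)^N$ for some integer $N\ge 0$.
   Context: $H^2=H^2(\mathbb{D})$ is the Hardy space of the open unit disk $\mathbb{D}$. "Analytic at $1$" means that $f$ extends analytically to a neighbourhood of the point $1$. $C_{\phi_a}f=f\circ\phi_a$ is a bounded operator on $H^2$. For non-zero $f\in H^2$, $K_f=\overline{\mathrm{span}\{C_{\phi_a}^n f:n\ge0\}}^{H^2}$ is the cyclic subspace generated by $f$. An invariant subspace is a closed subspace mapped into itself; it is minimal if it is non-zero and contains no invariant subspaces other than $\{0\}$ and itself. *)

theory Defs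
  imports "HOL-Complex_Analysis.Complex_Analysis"
begin

definition taylor_coeff :: "(complex \<Rightarrow> complex) \<Rightarrow> nat \<Rightarrow> complex" where
  "taylor_coeff f n = (deriv ^^ n) f 0 / fact n"

lemma taylor_coeff_add:
  assumes "f holomorphic_on ball 0 1" "g holomorphic_on ball 0 1"
  shows "taylor_coeff (\<lambda>z. f z + g z) n = taylor_coeff f n + taylor_coeff g n"
  using higher_deriv_add[OF assms, of 0 n] by (simp add: taylor_coeff_def add_divide_distrib)

lemma taylor_coeff_cmult:
  assumes "f holomorphic_on ball 0 1"
  shows "taylor_coeff (\<lambda>z. c * f z) n = c * taylor_coeff f n"
  using higher_deriv_cmult[OF assms, of 0 n c] by (simp add: taylor_coeff_def)

lemma taylor_coeff_0 [simp]: "taylor_coeff (\<lambda>z. 0) n = 0"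
  by (simp add: taylor_coeff_def)

lemma taylor_coeff_cong:
  assumes "f holomorphic_on ball 0 1" "g holomorphic_on ball 0 1"
    and "\<And>z. z \<in> ball 0 1 \<Longrightarrow> f z = g z"
  shows "taylor_coeff f n = taylor_coeff g n"
  using higher_deriv_transform_within_open[OF assms(1,2), of 0 n] assms(3)
  by (simp add: taylor_coeff_def)

text \<open>The Hardy space of the unit disc. Functions on the disc are represented by total functions
  that vanish off the disc, so that equality in the type is equality of functions on the disc.\<close>

definition hardy2_functions :: "(complex \<Rightarrow> complex) set" where
  "hardy2_functions = {f. f holomorphic_on ball 0 1 \<and>
     summable (\<lambda>n. (norm (taylor_coeff f n))\<^sup>2) \<and> (\<forall>z. z \<notin> ball 0 1 \<longrightarrow> f z = 0)}"

lemma norm_add_square_le: "(norm (x + y))\<^sup>2 \<le> 2 * (norm x)\<^sup>2 + 2 * (norm (y::complex))\<^sup>2"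
proof -
  have "(norm (x + y))\<^sup>2 \<le> (norm x + norm y)\<^sup>2"
    by (intro power_mono norm_triangle_ineq) auto
  also have "\<dots> \<le> 2 * (norm x)\<^sup>2 + 2 * (norm y)\<^sup>2"
    using sum_squares_bound[of "norm x" "norm y"] by (simp add: power2_sum)
  finally show ?thesis .
qed

lemma hardy2_functions_0: "(\<lambda>z. 0) \<in> hardy2_functions"
  by (simp add: hardy2_functions_def)

lemma hardy2_functions_add:
  assumes "f \<in> hardy2_functions" "g \<in> hardy2_functions"
  shows "(\<lambda>z. f z + g z) \<in> hardy2_functions"
proof -
  have "summable (\<lambda>n. 2 * (norm (taylor_coeff f n))\<^sup>2 + 2 * (norm (taylor_coeff g n))\<^sup>2)"
    using assms by (intro summable_add summable_mult) (auto simp: hardy2_functions_def)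
  then have "summable (\<lambda>n. (norm (taylor_coeff f n + taylor_coeff g n))\<^sup>2)"
    by (rule summable_comparison_test') (use norm_add_square_le in simp)
  with assms show ?thesis
    by (auto simp: hardy2_functions_def taylor_coeff_add intro!: holomorphic_intros)
qed

lemma hardy2_functions_cmult:
  assumes "f \<in> hardy2_functions"
  shows "(\<lambda>z. c * f z) \<in> hardy2_functions"
  using assms
  by (auto simp: hardy2_functions_def taylor_coeff_cmult norm_mult power_mult_distrib
      intro!: holomorphic_intros summable_mult)

typedef hardy2 = hardy2_functions
  morphisms h2_fun Abs_hardy2
  using hardy2_functions_0 by blast

setup_lifting type_definition_hardy2

lemma h2_fun_holomorphic: "h2_fun f holomorphic_on ball 0 1"
  using h2_fun[of f] by (simp add: hardy2_functions_def)

lemma h2_fun_outside: "z \<notin> ball 0 1 \<Longrightarrow> h2_fun f z = 0"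
  using h2_fun[of f] by (simp add: hardy2_functions_def)

lemma h2_eqI:
  assumes "\<And>z. z \<in> ball 0 1 \<Longrightarrow> h2_fun f z = h2_fun g z"
  shows "f = g"
proof -
  have "h2_fun f z = h2_fun g z" for z
    using assms h2_fun_outside by (cases "z \<in> ball 0 1") auto
  then show ?thesis
    by (metis h2_fun_inject ext)
qed

definition h2_coeff :: "hardy2 \<Rightarrow> nat \<Rightarrow> complex" where
  "h2_coeff f = taylor_coeff (h2_fun f)"

lemma h2_coeff_summable: "summable (\<lambda>n. (norm (h2_coeff f n))\<^sup>2)"
  using h2_fun[of f] by (simp add: hardy2_functions_def h2_coeff_def)

lemma h2_fun_sums:
  assumes "norm z < 1"
  shows "(\<lambda>n. h2_coeff f n * z ^ n) sums h2_fun f z"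
  using holomorphic_power_series[OF h2_fun_holomorphic, of z f] assms
  by (simp add: h2_coeff_def taylor_coeff_def)

lemma h2_coeff_inject: "h2_coeff f = h2_coeff g \<longleftrightarrow> f = g"
proof
  assume eq: "h2_coeff f = h2_coeff g"
  show "f = g"
  proof (rule h2_eqI)
    fix z :: complex
    assume "z \<in> ball 0 1"
    then have "norm z < 1"
      by simp
    from h2_fun_sums[OF this, of f] h2_fun_sums[OF this, of g]
    show "h2_fun f z = h2_fun g z"
      unfolding eq by (rule sums_unique2)
  qed
qed simp

instantiation hardy2 :: ab_group_add
begin

lift_definition zero_hardy2 :: hardy2 is "\<lambda>z. 0"
  by (rule hardy2_functions_0)

lift_definition plus_hardy2 :: "hardy2 \<Rightarrow> hardy2 \<Rightarrow> hardy2" is "\<lambda>f g z. f z + g z"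
  by (rule hardy2_functions_add)

lift_definition uminus_hardy2 :: "hardy2 \<Rightarrow> hardy2" is "\<lambda>f z. - f z"
  using hardy2_functions_cmult[of _ "-1"] by simp

definition minus_hardy2 :: "hardy2 \<Rightarrow> hardy2 \<Rightarrow> hardy2" where
  "minus_hardy2 f g = f + - g"

instance
  by standard (transfer; simp add: algebra_simps minus_hardy2_def)+

end

lift_definition scaleC_hardy2 :: "complex \<Rightarrow> hardy2 \<Rightarrow> hardy2" (infixr \<open>*\<^sub>C\<close> 75)
  is "\<lambda>c f z. c * f z"
  by (rule hardy2_functions_cmult)

text \<open>Complex subspaces and complex linear spans are \<open>h2.subspace\<close> and \<open>h2.span\<close>; the
  unqualified \<open>subspace\<close> and \<open>span\<close> refer to real scalars.\<close>

global_interpretation h2: vector_space scaleC_hardy2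
  by standard (transfer; simp add: algebra_simps)+

lemma h2_coeff_0 [simp]: "h2_coeff 0 n = 0"
  by (simp add: h2_coeff_def zero_hardy2.rep_eq)

lemma h2_coeff_add [simp]: "h2_coeff (f + g) n = h2_coeff f n + h2_coeff g n"
  by (simp add: h2_coeff_def plus_hardy2.rep_eq taylor_coeff_add h2_fun_holomorphic)

lemma h2_coeff_scaleC [simp]: "h2_coeff (c *\<^sub>C f) n = c * h2_coeff f n"
  by (simp add: h2_coeff_def scaleC_hardy2.rep_eq taylor_coeff_cmult h2_fun_holomorphic)

lemma h2_inner_summable: "summable (\<lambda>n. inner (h2_coeff f n) (h2_coeff g n))"
proof (rule summable_comparison_test')
  show "summable (\<lambda>n. (norm (h2_coeff f n))\<^sup>2 + (norm (h2_coeff g n))\<^sup>2)"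
    by (intro summable_add h2_coeff_summable)
  fix n
  have "\<bar>inner (h2_coeff f n) (h2_coeff g n)\<bar> \<le> norm (h2_coeff f n) * norm (h2_coeff g n)"
    by (rule Cauchy_Schwarz_ineq2)
  also have "\<dots> \<le> (norm (h2_coeff f n))\<^sup>2 + (norm (h2_coeff g n))\<^sup>2"
    using sum_squares_bound[of "norm (h2_coeff f n)" "norm (h2_coeff g n)"]
      mult_nonneg_nonneg[OF norm_ge_zero[of "h2_coeff f n"] norm_ge_zero[of "h2_coeff g n"]]
    by linarith
  finally show "norm (inner (h2_coeff f n) (h2_coeff g n))
      \<le> (norm (h2_coeff f n))\<^sup>2 + (norm (h2_coeff g n))\<^sup>2"
    by simp
qed

text \<open>The real inner product below is the real part of the Hardy space inner product
  \<open>\<Sum>n. h2_coeff f n * cnj (h2_coeff g n)\<close>; it induces the Hardy space norm.\<close>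

instantiation hardy2 :: real_inner
begin

definition scaleR_hardy2 :: "real \<Rightarrow> hardy2 \<Rightarrow> hardy2" where
  "scaleR_hardy2 r f = complex_of_real r *\<^sub>C f"

definition inner_hardy2 :: "hardy2 \<Rightarrow> hardy2 \<Rightarrow> real" where
  "inner_hardy2 f g = (\<Sum>n. inner (h2_coeff f n) (h2_coeff g n))"

definition norm_hardy2 :: "hardy2 \<Rightarrow> real" where
  "norm_hardy2 f = sqrt (\<Sum>n. (norm (h2_coeff f n))\<^sup>2)"

definition dist_hardy2 :: "hardy2 \<Rightarrow> hardy2 \<Rightarrow> real" where
  "dist_hardy2 f g = norm (f - g)"

definition sgn_hardy2 :: "hardy2 \<Rightarrow> hardy2" where
  "sgn_hardy2 f = inverse (norm f) *\<^sub>R f"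

definition uniformity_hardy2 :: "(hardy2 \<times> hardy2) filter" where
  "uniformity_hardy2 = (INF e\<in>{0<..}. principal {(f, g). dist f g < e})"

definition open_hardy2 :: "hardy2 set \<Rightarrow> bool" where
  "open_hardy2 U \<longleftrightarrow> (\<forall>x\<in>U. eventually (\<lambda>(x', y). x' = x \<longrightarrow> y \<in> U) uniformity)"

instance
proof
  fix f g h :: hardy2 and r s :: real and U :: "hardy2 set"
  show "r *\<^sub>R (f + g) = r *\<^sub>R f + r *\<^sub>R g"
    by (simp add: scaleR_hardy2_def h2.scale_right_distrib)
  show "(r + s) *\<^sub>R f = r *\<^sub>R f + s *\<^sub>R f"
    by (simp add: scaleR_hardy2_def h2.scale_left_distrib)
  show "r *\<^sub>R s *\<^sub>R f = (r * s) *\<^sub>R f" "1 *\<^sub>R f = f"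
    by (simp_all add: scaleR_hardy2_def)
  show "sgn f = inverse (norm f) *\<^sub>R f" "dist f g = norm (f - g)"
    "(uniformity :: (hardy2 \<times> hardy2) filter) = (INF e\<in>{0<..}. principal {(f, g). dist f g < e})"
    "open U \<longleftrightarrow> (\<forall>x\<in>U. eventually (\<lambda>(x', y). x' = x \<longrightarrow> y \<in> U) uniformity)"
    by (simp_all add: sgn_hardy2_def dist_hardy2_def uniformity_hardy2_def open_hardy2_def)
  show "inner f g = inner g f"
    by (simp add: inner_hardy2_def inner_commute)
  show "inner (f + g) h = inner f h + inner g h"
    by (simp add: inner_hardy2_def inner_add_left suminf_add h2_inner_summable)
  have "h2_coeff (r *\<^sub>R f) n = r *\<^sub>R h2_coeff f n" for n
    by (simp add: scaleR_hardy2_def scaleR_conv_of_real)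
  then show "inner (r *\<^sub>R f) g = r * inner f g"
    by (simp add: inner_hardy2_def suminf_mult h2_inner_summable)
  show "0 \<le> inner f f"
    by (simp add: inner_hardy2_def suminf_nonneg h2_inner_summable)
  have "inner f f = 0 \<longleftrightarrow> (\<forall>n. inner (h2_coeff f n) (h2_coeff f n) = 0)"
    unfolding inner_hardy2_def by (rule suminf_eq_zero_iff) (simp_all add: h2_inner_summable)
  also have "\<dots> \<longleftrightarrow> h2_coeff f = h2_coeff 0"
    by (simp add: fun_eq_iff)
  finally show "inner f f = 0 \<longleftrightarrow> f = 0"
    by (simp add: h2_coeff_inject)
  show "norm f = sqrt (inner f f)"
    by (simp add: inner_hardy2_def norm_hardy2_def power2_norm_eq_inner)
qed

end

text \<open>\<open>Abs_hardy2\<close> is meaningful only if the composition belongs to the Hardy space; for the maps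
  \<open>affine_symbol a\<close> this is lemma \<open>h2_fun_comp_op\<close> below.\<close>

definition comp_op :: "(complex \<Rightarrow> complex) \<Rightarrow> hardy2 \<Rightarrow> hardy2" where
  "comp_op \<phi> f = Abs_hardy2 (\<lambda>z. if z \<in> ball 0 1 then h2_fun f (\<phi> z) else 0)"

definition affine_symbol :: "real \<Rightarrow> complex \<Rightarrow> complex" where
  "affine_symbol a z = of_real a * z + (1 - of_real a)"

definition analytic_at_boundary_point :: "hardy2 \<Rightarrow> complex \<Rightarrow> bool" where
  "analytic_at_boundary_point f p \<longleftrightarrow>
     (\<exists>U g. open U \<and> p \<in> U \<and> g holomorphic_on U \<and> (\<forall>z \<in> U \<inter> ball 0 1. g z = h2_fun f z))"

definition cyclic_subspace :: "(hardy2 \<Rightarrow> hardy2) \<Rightarrow> hardy2 \<Rightarrow> hardy2 set" where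
  "cyclic_subspace T f = closure (h2.span (range (\<lambda>n. (T ^^ n) f)))"

definition invariant_subspace :: "(hardy2 \<Rightarrow> hardy2) \<Rightarrow> hardy2 set \<Rightarrow> bool" where
  "invariant_subspace T M \<longleftrightarrow> h2.subspace M \<and> closed M \<and> T ` M \<subseteq> M"

definition minimal_invariant_subspace :: "(hardy2 \<Rightarrow> hardy2) \<Rightarrow> hardy2 set \<Rightarrow> bool" where
  "minimal_invariant_subspace T M \<longleftrightarrow> invariant_subspace T M \<and> M \<noteq> {0} \<and>
     (\<forall>L. invariant_subspace T L \<and> L \<subseteq> M \<longrightarrow> L = {0} \<or> L = M)"

text \<open>The operator \<open>comp_op (affine_symbol a)\<close> is bounded for \<open>0 < a < 1\<close>, by the Schur test applied
  to its matrix \<open>(n choose k) * a ^ k * (1 - a) ^ (n - k)\<close> in the monomial basis.\<close>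

definition comp_matrix :: "real \<Rightarrow> nat \<Rightarrow> nat \<Rightarrow> real" where
  "comp_matrix a n k = real (n choose k) * a ^ k * (1 - a) ^ (n - k)"

lemma comp_matrix_nonneg: "0 < a \<Longrightarrow> a < 1 \<Longrightarrow> 0 \<le> comp_matrix a n k"
  by (simp add: comp_matrix_def)

lemma comp_matrix_eq_0: "n < k \<Longrightarrow> comp_matrix a n k = 0"
  by (simp add: comp_matrix_def)

lemma comp_matrix_Suc:
  "comp_matrix a (Suc n) (Suc k) = a * comp_matrix a n k + (1 - a) * comp_matrix a n (Suc k)"
proof (cases "Suc k \<le> n")
  case True
  then have "n - k = Suc (n - Suc k)"
    by simp
  then show ?thesis
    by (simp add: comp_matrix_def algebra_simps)
next
  case False
  then show ?thesis
    by (simp add: comp_matrix_def algebra_simps)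
qed

lemma comp_matrix_sum_n:
  assumes a: "0 < a" "a < 1"
  shows "(\<Sum>n<m. comp_matrix a n k) \<le> 1 / a"
proof (induction k arbitrary: m)
  case 0
  have "(\<Sum>n<m. (1 - a) ^ n) = (1 - (1 - a) ^ m) / a"
    using a by (simp add: sum_gp_strict)
  also have "\<dots> \<le> 1 / a"
    using a by (intro divide_right_mono) auto
  finally show ?case
    by (simp add: comp_matrix_def)
next
  case (Suc k)
  show ?case
  proof (cases m)
    case 0
    then show ?thesis
      using a by simp
  next
    case (Suc m')
    define S where "S = (\<Sum>n<Suc m'. comp_matrix a n (Suc k))"
    have "S = (\<Sum>n<m'. comp_matrix a (Suc n) (Suc k))"
      unfolding S_def by (subst sum.lessThan_Suc_shift) (simp add: comp_matrix_eq_0)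
    also have "\<dots> = a * (\<Sum>n<m'. comp_matrix a n k) + (1 - a) * (\<Sum>n<m'. comp_matrix a n (Suc k))"
      by (simp add: comp_matrix_Suc sum.distrib sum_distrib_left)
    also have "\<dots> \<le> a * (1 / a) + (1 - a) * S"
      unfolding S_def using a Suc.IH[of m']
      by (intro add_mono mult_left_mono) (auto simp: comp_matrix_nonneg)
    finally have "a * S \<le> 1"
      using a by (simp add: algebra_simps)
    then show ?thesis
      unfolding Suc S_def[symmetric] using a by (simp add: field_simps)
  qed
qed

lemma comp_matrix_sum_k:
  assumes a: "0 < a" "a < 1"
  shows "(\<Sum>k<m. comp_matrix a n k) \<le> 1"
proof -
  have "(\<Sum>k<m. comp_matrix a n k) \<le> (\<Sum>k<max m (Suc n). comp_matrix a n k)"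
    using a by (intro sum_mono2) (auto simp: comp_matrix_nonneg)
  also have "\<dots> = (\<Sum>k\<le>n. comp_matrix a n k)"
    by (intro sum.mono_neutral_right) (auto simp: comp_matrix_eq_0)
  also have "\<dots> = (a + (1 - a)) ^ n"
    unfolding comp_matrix_def binomial_ring by simp
  finally show ?thesis
    by simp
qed

lemma affine_symbol_in_ball:
  assumes a: "0 < a" "a < 1" and z: "z \<in> ball 0 1"
  shows "affine_symbol a z \<in> ball 0 1"
proof -
  have "norm (affine_symbol a z) \<le> norm (of_real a * z) + norm (of_real (1 - a) :: complex)"
    unfolding affine_symbol_def by (metis norm_triangle_ineq of_real_1 of_real_diff)
  also have "\<dots> = a * norm z + (1 - a)"
    using a by (simp only: norm_mult norm_of_real abs_of_pos diff_gt_0_iff_gt)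
  also have "\<dots> < 1"
    using a z by simp
  finally show ?thesis
    by simp
qed

lemma higher_deriv_power_series:
  assumes "\<And>z. norm z < 1 \<Longrightarrow> (\<lambda>n. c n * z ^ n) sums f z" and "norm (w::complex) < 1"
  shows "(\<lambda>n. (fact (n + k) / fact n) * c (n + k) * w ^ n) sums (deriv ^^ k) f w"
  using assms
proof (induction k arbitrary: w)
  case 0
  then show ?case
    by simp
next
  case (Suc k)
  define d where "d = (\<lambda>n. (fact (n + k) / fact n) * c (n + k))"
  have sums: "(\<lambda>n. d n * z ^ n) sums (deriv ^^ k) f z" if "norm z < 1" for z
    using Suc.IH[OF Suc.prems(1) that] by (simp add: d_def)
  have deriv: "((\<lambda>z. \<Sum>n. d n * z ^ n) has_field_derivative (\<Sum>n. diffs d n * w ^ n)) (at w)"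
    by (rule termdiffs_strong'[where K = 1]) (use sums Suc.prems in \<open>auto simp: sums_iff\<close>)
  have "((deriv ^^ k) f has_field_derivative (\<Sum>n. diffs d n * w ^ n)) (at w)"
    by (rule has_field_derivative_transform_within_open[OF deriv, of "ball 0 1"])
      (use sums Suc.prems in \<open>auto simp: sums_iff\<close>)
  then have "(deriv ^^ Suc k) f w = (\<Sum>n. diffs d n * w ^ n)"
    by (simp add: DERIV_imp_deriv)
  moreover have "summable (\<lambda>n. diffs d n * w ^ n)"
    by (rule termdiff_converges[where K = 1]) (use sums Suc.prems in \<open>auto simp: sums_iff\<close>)
  ultimately have "(\<lambda>n. diffs d n * w ^ n) sums (deriv ^^ Suc k) f w"
    by (simp add: sums_iff)
  moreover have "diffs d n = (fact (n + Suc k) / fact n) * c (n + Suc k)" for n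
    by (simp add: diffs_def d_def field_simps del: of_nat_Suc)
  ultimately show ?case
    by simp
qed

lemma taylor_coeff_affine_sums:
  assumes a: "0 < a" "a < 1"
  shows "(\<lambda>n. of_real (comp_matrix a n k) * h2_coeff f n) sums
           taylor_coeff (\<lambda>z. h2_fun f (affine_symbol a z)) k"
proof -
  define b where "b = complex_of_real (1 - a)"
  have nb: "norm b < 1"
    unfolding b_def norm_of_real using a by simp
  have "taylor_coeff (\<lambda>z. h2_fun f (affine_symbol a z)) k
      = of_real a ^ k * (deriv ^^ k) (h2_fun f) b / fact k"
    using higher_deriv_compose_linear'[where S = "ball 0 1" and z = 0 and u = "of_real a"
        and c = "1 - of_real a" and n = k, OF h2_fun_holomorphic open_ball open_ball] affine_symbol_in_ball[OF a]
    by (simp add: taylor_coeff_def affine_symbol_def b_def)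
  moreover have "(\<lambda>n. of_real a ^ k / fact k *
      ((fact (n + k) / fact n) * h2_coeff f (n + k) * b ^ n)) sums
      (of_real a ^ k / fact k * (deriv ^^ k) (h2_fun f) b)"
    by (intro sums_mult higher_deriv_power_series h2_fun_sums nb)
  moreover have "of_real a ^ k / fact k * ((fact (n + k) / fact n) * h2_coeff f (n + k) * b ^ n)
      = of_real (comp_matrix a (n + k) k) * h2_coeff f (n + k)" for n
    by (simp add: comp_matrix_def b_def binomial_fact field_simps)
  ultimately have "(\<lambda>n. of_real (comp_matrix a (n + k) k) * h2_coeff f (n + k)) sums
      taylor_coeff (\<lambda>z. h2_fun f (affine_symbol a z)) k"
    by simp
  then show ?thesis
    by (subst (asm) sums_zero_iff_shift) (auto simp: comp_matrix_eq_0)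
qed

lemma taylor_coeff_affine_bound:
  assumes a: "0 < a" "a < 1"
  shows "(\<Sum>k<K. (norm (taylor_coeff (\<lambda>z. h2_fun f (affine_symbol a z)) k))\<^sup>2)
           \<le> 1 / a * (norm f)\<^sup>2"
proof -
  define s where "s = (\<lambda>k m. \<Sum>n<m. of_real (comp_matrix a n k) * h2_coeff f n)"
  have norm_f: "(norm f)\<^sup>2 = (\<Sum>n. (norm (h2_coeff f n))\<^sup>2)"
    by (simp add: norm_hardy2_def suminf_nonneg h2_coeff_summable)
  have s_le: "(norm (s k m))\<^sup>2 \<le> 1 / a * (\<Sum>n<m. comp_matrix a n k * (norm (h2_coeff f n))\<^sup>2)" for k m
  proof -
    have "norm (s k m) \<le> (\<Sum>n<m. norm (of_real (comp_matrix a n k) * h2_coeff f n))"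
      unfolding s_def by (rule norm_sum)
    also have "\<dots> = (\<Sum>n<m. sqrt (comp_matrix a n k) * (sqrt (comp_matrix a n k) * norm (h2_coeff f n)))"
      using a by (intro sum.cong)
        (auto simp: norm_mult comp_matrix_nonneg simp flip: mult.assoc real_sqrt_mult)
    finally have "(norm (s k m))\<^sup>2 \<le> \<dots>\<^sup>2"
      by (intro power_mono) auto
    also have "\<dots> \<le> (\<Sum>n<m. (sqrt (comp_matrix a n k))\<^sup>2) *
        (\<Sum>n<m. (sqrt (comp_matrix a n k) * norm (h2_coeff f n))\<^sup>2)"
      by (rule Cauchy_Schwarz_ineq_sum)
    also have "\<dots> = (\<Sum>n<m. comp_matrix a n k) *
        (\<Sum>n<m. comp_matrix a n k * (norm (h2_coeff f n))\<^sup>2)"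
      using a by (simp add: power_mult_distrib comp_matrix_nonneg)
    also have "\<dots> \<le> 1 / a * (\<Sum>n<m. comp_matrix a n k * (norm (h2_coeff f n))\<^sup>2)"
      using a by (intro mult_right_mono comp_matrix_sum_n sum_nonneg)
        (auto simp: comp_matrix_nonneg)
    finally show ?thesis .
  qed
  have "(\<Sum>k<K. (norm (s k m))\<^sup>2) \<le> 1 / a * (norm f)\<^sup>2" for m
  proof -
    have "(\<Sum>k<K. (norm (s k m))\<^sup>2)
        \<le> (\<Sum>k<K. 1 / a * (\<Sum>n<m. comp_matrix a n k * (norm (h2_coeff f n))\<^sup>2))"
      by (intro sum_mono s_le)
    also have "\<dots> = 1 / a * (\<Sum>n<m. (\<Sum>k<K. comp_matrix a n k) * (norm (h2_coeff f n))\<^sup>2)"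
      unfolding sum_distrib_left[symmetric] sum_distrib_right by (subst sum.swap) simp
    also have "\<dots> \<le> 1 / a * (\<Sum>n<m. 1 * (norm (h2_coeff f n))\<^sup>2)"
      using a by (intro mult_left_mono sum_mono mult_right_mono comp_matrix_sum_k) auto
    also have "\<dots> \<le> 1 / a * (\<Sum>n. (norm (h2_coeff f n))\<^sup>2)"
      using a unfolding mult_1
      by (intro mult_left_mono sum_le_suminf h2_coeff_summable) auto
    finally show ?thesis
      by (simp add: norm_f)
  qed
  moreover have "(\<lambda>m. \<Sum>k<K. (norm (s k m))\<^sup>2) \<longlonglongrightarrow>
      (\<Sum>k<K. (norm (taylor_coeff (\<lambda>z. h2_fun f (affine_symbol a z)) k))\<^sup>2)"
    using taylor_coeff_affine_sums[OF a] unfolding sums_def s_def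
    by (intro tendsto_intros) auto
  ultimately show ?thesis
    by (intro LIMSEQ_le_const2) auto
qed

lemma comp_op_affine_in_hardy2:
  assumes a: "0 < a" "a < 1"
  shows "(\<lambda>z. if z \<in> ball 0 1 then h2_fun f (affine_symbol a z) else 0) \<in> hardy2_functions"
    and "taylor_coeff (\<lambda>z. if z \<in> ball 0 1 then h2_fun f (affine_symbol a z) else 0) =
         taylor_coeff (\<lambda>z. h2_fun f (affine_symbol a z))"
proof -
  let ?g = "\<lambda>z. h2_fun f (affine_symbol a z)"
  let ?h = "\<lambda>z. if z \<in> ball 0 1 then ?g z else 0"
  have "(h2_fun f \<circ> affine_symbol a) holomorphic_on ball 0 1"
    unfolding affine_symbol_def
    by (rule holomorphic_on_compose_gen[OF _ h2_fun_holomorphic])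
      (use affine_symbol_in_ball[OF a] in \<open>auto simp: affine_symbol_def intro!: holomorphic_intros\<close>)
  then have g: "?g holomorphic_on ball 0 1"
    by (simp add: o_def)
  then have h: "?h holomorphic_on ball 0 1"
    by (rule holomorphic_transform) simp
  show eq: "taylor_coeff ?h = taylor_coeff ?g"
    by (rule ext, rule taylor_coeff_cong[OF h g]) simp
  have "summable (\<lambda>k. (norm (taylor_coeff ?g k))\<^sup>2)"
    by (rule summableI_nonneg_bounded[OF _ taylor_coeff_affine_bound[OF a]]) auto
  with h show "?h \<in> hardy2_functions"
    unfolding hardy2_functions_def mem_Collect_eq eq by simp
qed

lemma h2_fun_comp_op:
  assumes "0 < a" "a < 1" "z \<in> ball 0 1"
  shows "h2_fun (comp_op (affine_symbol a) f) z = h2_fun f (affine_symbol a z)"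
  unfolding comp_op_def Abs_hardy2_inverse[OF comp_op_affine_in_hardy2(1)[OF assms(1,2)]]
  using assms(3) by simp

lemma norm_comp_op_le:
  assumes a: "0 < a" "a < 1"
  shows "norm (comp_op (affine_symbol a) f) \<le> 1 / sqrt a * norm f"
proof -
  have "(norm (comp_op (affine_symbol a) f))\<^sup>2
      = (\<Sum>k. (norm (h2_coeff (comp_op (affine_symbol a) f) k))\<^sup>2)"
    by (simp add: norm_hardy2_def suminf_nonneg h2_coeff_summable)
  also have coeff: "h2_coeff (comp_op (affine_symbol a) f) = taylor_coeff (\<lambda>z. h2_fun f (affine_symbol a z))"
    unfolding h2_coeff_def comp_op_def Abs_hardy2_inverse[OF comp_op_affine_in_hardy2(1)[OF a]]
    by (rule comp_op_affine_in_hardy2(2)[OF a])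
  finally have "(norm (comp_op (affine_symbol a) f))\<^sup>2 \<le> 1 / a * (norm f)\<^sup>2"
    using h2_coeff_summable[of "comp_op (affine_symbol a) f"] taylor_coeff_affine_bound[OF a]
    unfolding coeff by (metis suminf_le_const)
  also have "\<dots> = (1 / sqrt a * norm f)\<^sup>2"
    using a by (simp add: power_mult_distrib power_divide)
  finally show ?thesis
    by (rule power2_le_imp_le) (use a in simp)
qed

lemma bounded_linear_comp_op:
  assumes a: "0 < a" "a < 1"
  shows "bounded_linear (comp_op (affine_symbol a))"
    and "comp_op (affine_symbol a) (c *\<^sub>C f) = c *\<^sub>C comp_op (affine_symbol a) f"
proof -
  note eval = h2_fun_comp_op[OF a] plus_hardy2.rep_eq scaleC_hardy2.rep_eq
  show scale: "comp_op (affine_symbol a) (c *\<^sub>C f) = c *\<^sub>C comp_op (affine_symbol a) f" for c f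
    by (rule h2_eqI) (simp add: eval del: mem_ball)
  show "bounded_linear (comp_op (affine_symbol a))"
  proof (rule bounded_linear_intro[where K = "1 / sqrt a"])
    show "comp_op (affine_symbol a) (f + g) = comp_op (affine_symbol a) f + comp_op (affine_symbol a) g" for f g
      by (rule h2_eqI) (simp add: eval del: mem_ball)
  qed (use norm_comp_op_le[OF a] in \<open>simp_all add: scaleR_hardy2_def scale mult.commute\<close>)
qed

end

theory Submission
  imports Defs
begin

text \<open>
  Write \<open>T\<close> for the composition operator. The symbol fixes \<open>1\<close> and contracts towards it: if \<open>z\<close>
  is replaced by its image, \<open>1 - z\<close> is multiplied by \<open>a\<close>. Hence \<open>(1 - z) ^ N\<close> is an eigenvector
  of \<open>T\<close> with eigenvalue \<open>a ^ N\<close>. The cyclic subspace generated by an eigenvector is the line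
  through it (\<open>cyclic_subspace_eigenvector\<close>), and this line is minimal because it has dimension
  one (\<open>minimal_invariant_subspace_eigenline\<close>).

  The converse is a blow-up argument at the fixed point. The iterate \<open>(T ^^ n) f\<close> is
  \<open>z \<mapsto> f (1 + a ^ n * (z - 1))\<close>, so for large \<open>n\<close> it depends only on the values of \<open>f\<close> near \<open>1\<close>. There
  analyticity gives \<open>f w = h w * (1 - w) ^ N\<close> with \<open>h 1 \<noteq> 0\<close>
  (\<open>boundary_point_factorization\<close>), and after division by \<open>(a ^ n) ^ N\<close> the iterate becomes
  \<open>h (1 + a ^ n * (z - 1)) * (1 - z) ^ N\<close>, which tends to \<open>h 1 * (1 - z) ^ N\<close>. The convergence is
  uniform on the disc of radius \<open>2\<close>, and Cauchy's estimates for the Taylor coefficients turn this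
  into convergence in the Hardy space (\<open>norm_hardy2_le_sup_cball\<close>,
  \<open>rescaled_iterates_tendsto\<close>). So the cyclic subspace of \<open>f\<close> always contains some eigenvector
  \<open>h 1 * (1 - z) ^ N\<close>. If the cyclic subspace is minimal, it must be the line through this
  eigenvector, and \<open>f\<close> lies on that line.
\<close>

section \<open>Eigenvectors and minimal invariant subspaces\<close>

lemma norm_scaleC: "norm (c *\<^sub>C u) = norm c * norm (u :: hardy2)"
  by (simp add: norm_hardy2_def norm_mult power_mult_distrib suminf_mult h2_coeff_summable
      real_sqrt_mult)

text \<open>The map \<open>c \<mapsto> c *\<^sub>C u\<close> multiplies all distances by the norm of \<open>u\<close>, so the line inherits
  completeness from the complex numbers.\<close>

lemma closed_line: "closed (h2.span {u :: hardy2})"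
proof (cases "u = 0")
  case True
  then show ?thesis
    by simp
next
  case False
  have "bounded_linear (\<lambda>c. c *\<^sub>C u)"
    by (rule bounded_linear_intro[where K = "norm u"])
      (auto simp: h2.scale_left_distrib scaleR_hardy2_def norm_scaleC scaleR_conv_of_real)
  then have "complete (range (\<lambda>c. c *\<^sub>C u))"
    by (rule complete_isometric_image[where e = "norm u", rotated 2])
      (use False in \<open>auto simp: norm_scaleC complete_UNIV\<close>)
  then show ?thesis
    by (simp add: h2.span_singleton complete_imp_closed)
qed

lemma invariant_eigenline:
  assumes scale: "\<And>c u. T (c *\<^sub>C u) = c *\<^sub>C T u" and eigen: "T u = l *\<^sub>C u"
  shows "invariant_subspace T (h2.span {u})"
proof -
  have "T ` h2.span {u} \<subseteq> h2.span {u}"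
    by (auto simp: h2.span_singleton scale eigen)
  then show ?thesis
    by (simp add: invariant_subspace_def closed_line)
qed

lemma minimal_invariant_subspace_eigenline:
  assumes "\<And>c u. T (c *\<^sub>C u) = c *\<^sub>C T u" and "T u = l *\<^sub>C u" and "u \<noteq> 0"
  shows "minimal_invariant_subspace T (h2.span {u})"
  unfolding minimal_invariant_subspace_def
proof (intro conjI allI impI)
  show "invariant_subspace T (h2.span {u})"
    using assms(1,2) by (rule invariant_eigenline)
  show "h2.span {u} \<noteq> {0}"
    using h2.span_base[of u "{u}"] \<open>u \<noteq> 0\<close> by auto
  fix L
  assume L: "invariant_subspace T L \<and> L \<subseteq> h2.span {u}"
  then have sub: "h2.subspace L"
    by (simp add: invariant_subspace_def)
  show "L = {0} \<or> L = h2.span {u}"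
  proof (cases "L = {0}")
    case False
    then obtain v where "v \<in> L" "v \<noteq> 0"
      using h2.subspace_0[OF sub] by blast
    moreover from this obtain c where c: "v = c *\<^sub>C u"
      using L by (auto simp: h2.span_singleton)
    ultimately have "inverse c *\<^sub>C v = u"
      by auto
    then have "u \<in> L"
      using h2.subspace_scale[OF sub \<open>v \<in> L\<close>] by metis
    then have "h2.span {u} \<subseteq> L"
      using sub by (intro h2.span_minimal) auto
    with L show ?thesis
      by auto
  qed simp
qed

text \<open>The line through an eigenvector is itself an invariant subspace (it is closed), so a minimal
  subspace that contains the eigenvector leaves room for nothing else.\<close>

lemma minimal_invariant_subspace_with_eigenvector:
  assumes "minimal_invariant_subspace T M" and "\<And>c u. T (c *\<^sub>C u) = c *\<^sub>C T u"
    and "T u = l *\<^sub>C u" and "u \<noteq> 0" and "u \<in> M"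
  shows "M = h2.span {u}"
proof -
  have "h2.span {u} \<subseteq> M"
    using assms(1,5) by (intro h2.span_minimal)
      (auto simp: minimal_invariant_subspace_def invariant_subspace_def)
  moreover have "h2.span {u} \<noteq> {0}"
    using h2.span_base[of u "{u}"] \<open>u \<noteq> 0\<close> by auto
  ultimately show ?thesis
    using assms(1) invariant_eigenline[of T u l, OF assms(2,3)]
    unfolding minimal_invariant_subspace_def by blast
qed

text \<open>The orbit of an eigenvector stays on its line, and closing the line adds nothing.\<close>

lemma cyclic_subspace_eigenvector:
  assumes scale: "\<And>c u. T (c *\<^sub>C u) = c *\<^sub>C T u" and eigen: "T u = l *\<^sub>C u"
  shows "cyclic_subspace T u = h2.span {u}"
proof -
  have iterate: "(T ^^ n) u = (l ^ n) *\<^sub>C u" for n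
    by (induction n) (simp_all add: scale eigen mult.commute)
  have "h2.span (range (\<lambda>n. (T ^^ n) u)) = h2.span {u}"
  proof (rule h2.span_eq[THEN iffD2], intro conjI)
    show "range (\<lambda>n. (T ^^ n) u) \<subseteq> h2.span {u}"
      by (auto simp: iterate h2.span_singleton)
    have "u \<in> range (\<lambda>n. (T ^^ n) u)"
      by (rule range_eqI[of _ _ 0]) simp
    then show "{u} \<subseteq> h2.span (range (\<lambda>n. (T ^^ n) u))"
      by (auto intro: h2.span_base)
  qed
  then show ?thesis
    unfolding cyclic_subspace_def by (simp add: closed_line)
qed

text \<open>This is how eigenvectors are found in a cyclic subspace: the iterates themselves may tend to
  zero, but a rescaling of them can have a non-zero limit.\<close>

lemma scaled_iterate_limit_in_cyclic_subspace:
  assumes "(\<lambda>n. c n *\<^sub>C (T ^^ n) f) \<longlonglongrightarrow> u"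
  shows "u \<in> cyclic_subspace T f"
  unfolding cyclic_subspace_def closure_sequential
  by (rule exI[of _ "\<lambda>n. c n *\<^sub>C (T ^^ n) f"])
    (auto intro!: assms intro: h2.span_scale h2.span_base)

lemma base_in_cyclic_subspace: "f \<in> cyclic_subspace T f"
  unfolding cyclic_subspace_def
  by (intro subsetD[OF closure_subset] h2.span_base range_eqI[of _ _ 0]) simp

section \<open>Functions holomorphic on a larger disc\<close>

lemma taylor_coeff_Cauchy_bound:
  assumes "g holomorphic_on cball 0 r" and "0 < r"
    and "\<And>z. norm z = r \<Longrightarrow> norm (g z) \<le> B"
  shows "norm (taylor_coeff g n) \<le> B * (1 / r) ^ n"
proof -
  have "norm ((deriv ^^ n) g 0) \<le> fact n * B / r ^ n"
    using assms by (intro Cauchy_inequality)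
      (auto intro: holomorphic_on_imp_continuous_on)
  then show ?thesis
    by (simp add: taylor_coeff_def norm_divide field_simps)
qed

lemma square_geometric_sums:
  assumes "1 < (r::real)"
  shows "(\<lambda>n. (B * (1 / r) ^ n)\<^sup>2) sums (B\<^sup>2 / (1 - 1 / r\<^sup>2))"
proof -
  have "1 < r\<^sup>2"
    using assms by simp
  then have "(\<lambda>n. B\<^sup>2 * (1 / r\<^sup>2) ^ n) sums (B\<^sup>2 * (1 / (1 - 1 / r\<^sup>2)))"
    by (intro sums_mult geometric_sums) (auto simp: norm_divide norm_power divide_less_eq)
  then show ?thesis
    by (simp add: power_mult_distrib power_divide mult.commute flip: power_mult)
qed

lemma hardy2_of_holomorphic_on_cball:
  assumes g: "g holomorphic_on cball 0 r" and r: "1 < r"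
  obtains u where "\<And>z. z \<in> ball 0 1 \<Longrightarrow> h2_fun u z = g z"
proof -
  define g' where "g' = (\<lambda>z. if z \<in> ball 0 1 then g z else 0)"
  have hol: "g holomorphic_on ball 0 1"
    using r by (intro holomorphic_on_subset[OF g]) auto
  have hol': "g' holomorphic_on ball 0 1"
    by (rule holomorphic_transform[OF hol]) (simp add: g'_def)
  have "compact (g ` sphere 0 r)"
    by (intro compact_continuous_image holomorphic_on_imp_continuous_on holomorphic_on_subset[OF g])
      auto
  then obtain B where B: "\<And>z. norm z = r \<Longrightarrow> norm (g z) \<le> B"
    using compact_imp_bounded bounded_iff by (metis imageI mem_sphere_0)
  have "summable (\<lambda>n. (norm (taylor_coeff g n))\<^sup>2)"
  proof (rule summable_comparison_test'[OF sums_summable[OF square_geometric_sums[OF r]]])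
    show "norm ((norm (taylor_coeff g n))\<^sup>2) \<le> (B * (1 / r) ^ n)\<^sup>2" for n
      using r taylor_coeff_Cauchy_bound[OF g _ B, of n] by (simp add: power_mono)
  qed
  moreover have "taylor_coeff g' = taylor_coeff g"
    by (rule ext, rule taylor_coeff_cong[OF hol' hol]) (simp add: g'_def)
  ultimately have "g' \<in> hardy2_functions"
    using hol' by (simp add: hardy2_functions_def) (simp add: g'_def)
  then show thesis
    by (intro that[of "Abs_hardy2 g'"]) (simp add: Abs_hardy2_inverse, simp add: g'_def)
qed

text \<open>By Cauchy's estimates the Taylor coefficients of \<open>g\<close> are at most \<open>B * (1 / r) ^ n\<close>, and these
  bounds are square summable as \<open>r\<close> exceeds \<open>1\<close>. So uniform convergence on a larger disc implies
  convergence in the Hardy space.\<close>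

lemma norm_hardy2_le_sup_cball:
  assumes g: "g holomorphic_on cball 0 r" and r: "1 < r"
    and u: "\<And>z. z \<in> ball 0 1 \<Longrightarrow> h2_fun u z = g z"
    and B: "0 \<le> B" "\<And>z. norm z = r \<Longrightarrow> norm (g z) \<le> B"
  shows "norm u \<le> B / sqrt (1 - 1 / r\<^sup>2)"
proof -
  have coeff: "h2_coeff u n = taylor_coeff g n" for n
    unfolding h2_coeff_def using r u
    by (intro taylor_coeff_cong h2_fun_holomorphic holomorphic_on_subset[OF g]) auto
  have "(\<Sum>n. (norm (h2_coeff u n))\<^sup>2) \<le> (\<Sum>n. (B * (1 / r) ^ n)\<^sup>2)"
    using square_geometric_sums[OF r] r
    by (intro suminf_le h2_coeff_summable)
      (auto simp: coeff sums_iff intro!: power_mono taylor_coeff_Cauchy_bound[OF g] B)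
  then have "norm u \<le> sqrt (B\<^sup>2 / (1 - 1 / r\<^sup>2))"
    unfolding norm_hardy2_def using square_geometric_sums[OF r] by (simp add: sums_iff)
  then show ?thesis
    using B(1) by (simp add: real_sqrt_divide)
qed

section \<open>Blowing up at the fixed point\<close>

lemma h2_fun_comp_op_funpow:
  assumes a: "0 < a" "a < 1" and z: "z \<in> ball 0 1"
  shows "h2_fun ((comp_op (affine_symbol a) ^^ n) f) z = h2_fun f (1 + of_real (a ^ n) * (z - 1))"
  using z
proof (induction n arbitrary: z)
  case (Suc n)
  have "1 + of_real (a ^ n) * (affine_symbol a z - 1) = 1 + of_real (a ^ Suc n) * (z - 1)"
    by (simp add: affine_symbol_def algebra_simps)
  then show ?case
    using Suc.IH[OF affine_symbol_in_ball[OF a Suc.prems]] Suc.prems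
    by (simp only: funpow.simps o_apply h2_fun_comp_op[OF a])
qed simp

lemma comp_op_affine_eigenvector:
  assumes a: "0 < a" "a < 1" and u: "\<And>z. z \<in> ball 0 1 \<Longrightarrow> h2_fun u z = c * (1 - z) ^ N"
  shows "comp_op (affine_symbol a) u = of_real (a ^ N) *\<^sub>C u"
proof (rule h2_eqI)
  fix z :: complex
  assume z: "z \<in> ball 0 1"
  have "1 - affine_symbol a z = of_real a * (1 - z)"
    by (simp add: affine_symbol_def algebra_simps)
  then show "h2_fun (comp_op (affine_symbol a) u) z = h2_fun (of_real (a ^ N) *\<^sub>C u) z"
    using u[OF z] u[OF affine_symbol_in_ball[OF a z]]
    by (simp add: h2_fun_comp_op[OF a z] scaleC_hardy2.rep_eq power_mult_distrib)
qed

text \<open>The power of \<open>1 - w\<close> is the order of the zero at \<open>1\<close> of the analytic extension. This order is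
  finite: the extension agrees with \<open>f\<close> where a neighbourhood of \<open>1\<close> meets the disc, so if it
  vanished near \<open>1\<close> the identity theorem would make \<open>f\<close> zero.\<close>

lemma boundary_point_factorization:
  assumes f: "f \<noteq> 0" "analytic_at_boundary_point f 1"
  obtains N h d where "0 < d" "h holomorphic_on cball 1 d" "h 1 \<noteq> 0"
    "\<And>w. w \<in> cball 1 d \<Longrightarrow> norm w < 1 \<Longrightarrow> h2_fun f w = h w * (1 - w) ^ N"
proof -
  from f(2) obtain U g where U: "open U" "1 \<in> U" "g holomorphic_on U"
    and gf: "\<And>z. z \<in> U \<Longrightarrow> norm z < 1 \<Longrightarrow> g z = h2_fun f z"
    by (auto simp: analytic_at_boundary_point_def)
  obtain e where e: "0 < e" "ball 1 e \<subseteq> U"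
    using U open_contains_ball by blast
  have gh: "g holomorphic_on ball 1 e"
    using U(3) e(2) by (rule holomorphic_on_subset)
  have nonzero: "\<exists>w\<in>ball 1 e. g w \<noteq> 0"
  proof (rule ccontr)
    assume "\<not> ?thesis"
    then have zero: "h2_fun f w = 0" if "w \<in> ball 1 e \<inter> ball 0 1" for w
      using that gf e by fastforce
    have "ball 1 e \<inter> ball (0::complex) 1 \<noteq> {}"
    proof -
      \<comment> \<open>a point of the real axis slightly to the left of \<open>1\<close>\<close>
      define x where "x = 1 - min e 1 / 2"
      have "dist 1 (complex_of_real x) = \<bar>1 - x\<bar>"
        unfolding dist_norm by (metis norm_of_real of_real_1 of_real_diff)
      then have "complex_of_real x \<in> ball 1 e \<inter> ball 0 1"
        using e(1) by (auto simp: x_def simp del: of_real_diff of_real_divide)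
      then show ?thesis
        by blast
    qed
    then have "h2_fun f z = 0" if "z \<in> ball 0 1" for z
      using that zero
      by (intro analytic_continuation_open[of "ball 1 e \<inter> ball 0 1" "ball 0 1" "h2_fun f" "\<lambda>_. 0" z])
        (auto intro: h2_fun_holomorphic)
    then have "f = 0"
      by (intro h2_eqI) (simp add: zero_hardy2.rep_eq)
    with f(1) show False ..
  qed
  define h where "h = zor_poly g 1"
  have "1 \<in> ball (1::complex) e"
    using e(1) by simp
  from zorder_exist_zero[OF gh open_ball connected_ball this nonzero, THEN conjunct2, folded h_def]
  obtain d where d: "0 < d" "cball (1::complex) d \<subseteq> ball 1 e" "h holomorphic_on cball 1 d"
    and h: "\<forall>w\<in>cball 1 d. g w = h w * (w - 1) ^ nat (zorder g 1) \<and> h w \<noteq> 0"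
    by blast
  define N where "N = nat (zorder g 1)"
  have "h2_fun f w = (-1) ^ N * h w * (1 - w) ^ N" if "w \<in> cball 1 d" "norm w < 1" for w
  proof -
    have "h2_fun f w = g w"
      using that d(2) e(2) by (intro gf[symmetric]) auto
    also have "\<dots> = h w * (- 1 * (1 - w)) ^ N"
      using bspec[OF h that(1)] by (simp add: N_def)
    finally show ?thesis
      by (simp only: power_mult_distrib ac_simps)
  qed
  then show thesis
    using bspec[OF h, of 1] d by (intro that[of d "\<lambda>w. (-1) ^ N * h w" N]) (auto intro!: holomorphic_intros)
qed

text \<open>With \<open>t = a ^ n\<close>, the difference to the limit is
  \<open>(1 - z) ^ N * (h (1 + t * (z - 1)) - h 1)\<close>, since the factor \<open>t ^ N\<close> from \<open>(t * (1 - z)) ^ N\<close>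
  cancels. For small \<open>t\<close> this extends to the disc of radius \<open>2\<close>, where the first factor is bounded
  by \<open>3 ^ N\<close> and the second is uniformly small by continuity of \<open>h\<close> at \<open>1\<close>.\<close>

lemma rescaled_iterates_tendsto:
  assumes a: "0 < a" "a < 1"
    and h: "0 < d" "h holomorphic_on cball 1 d"
    and f: "\<And>w. w \<in> cball 1 d \<Longrightarrow> norm w < 1 \<Longrightarrow> h2_fun f w = h w * (1 - w) ^ N"
    and u: "\<And>z. z \<in> ball 0 1 \<Longrightarrow> h2_fun u z = h 1 * (1 - z) ^ N"
  shows "(\<lambda>n. (1 / of_real (a ^ n) ^ N) *\<^sub>C (comp_op (affine_symbol a) ^^ n) f) \<longlonglongrightarrow> u"
proof (rule tendsto_norm_zero_cancel[THEN Lim_null[THEN iffD2]], rule LIMSEQ_I)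
  fix eps :: real
  assume eps: "0 < eps"
  \<comment> \<open>On the disc of radius \<open>2\<close> a sup bound \<open>C\<close> gives norm at most \<open>C / s\<close>; the choice of \<open>B\<close> makes
    this \<open>eps / 2\<close> for \<open>C = 3 ^ N * B\<close>.\<close>
  define s where "s = sqrt (1 - 1 / (2::real)\<^sup>2)"
  have s: "0 < s"
    by (simp add: s_def)
  define B where "B = eps * s / 2 / 3 ^ N"
  have B: "0 < B" using eps s by (simp add: B_def)
  have "continuous_on (cball 1 d) h"
    using h(2) by (rule holomorphic_on_imp_continuous_on)
  then obtain d' where d': "0 < d'"
    and close: "\<And>w. w \<in> cball 1 d \<Longrightarrow> dist w 1 < d' \<Longrightarrow> dist (h w) (h 1) < B"
    using B h(1) unfolding continuous_on_iff by (metis centre_in_cball less_imp_le)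
  have "(\<lambda>n. a ^ n * 3) \<longlonglongrightarrow> 0 * 3"
    using a by (intro tendsto_intros LIMSEQ_realpow_zero) auto
  then obtain n0 where n0: "\<And>n. n \<ge> n0 \<Longrightarrow> a ^ n * 3 < min d d'"
    using order_tendstoD(2)[of "\<lambda>n. a ^ n * 3" "0 * 3" sequentially "min d d'"] h(1) d'
    unfolding eventually_sequentially by auto
  show "\<exists>n0. \<forall>n\<ge>n0. norm (norm ((1 / of_real (a ^ n) ^ N) *\<^sub>C (comp_op (affine_symbol a) ^^ n) f - u) - 0) < eps"
  proof (intro exI allI impI)
    fix n assume "n \<ge> n0"
    define t where "t = a ^ n"
    have t: "0 < t" "t \<le> 1" "t * 3 < d" "t * 3 < d'"
      using a n0[OF \<open>n \<ge> n0\<close>] by (auto simp: t_def power_le_one)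
    define k where "k = (\<lambda>z. 1 + of_real t * (z - 1) :: complex)"
    have dist_k: "dist (k z) 1 \<le> t * 3" if "norm z \<le> 2" for z
    proof -
      have "norm (z - 1) \<le> 3"
        using norm_triangle_ineq4[of z 1] that by simp
      then show ?thesis
        using t by (simp add: k_def dist_norm norm_mult)
    qed
    have k: "k z \<in> cball 1 d" "dist (k z) 1 < d'" if "norm z \<le> 2" for z
      using dist_k[OF that] t by (auto simp: dist_commute)
    define g where "g = (\<lambda>z. (1 - z) ^ N * (h (k z) - h 1))"
    have "(h \<circ> k) holomorphic_on cball 0 2"
      by (rule holomorphic_on_compose_gen[OF _ h(2)])
        (use k in \<open>auto simp: k_def intro!: holomorphic_intros\<close>)
    then have g_hol: "g holomorphic_on cball 0 2"
      unfolding g_def o_def by (intro holomorphic_intros)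
    have g_bound: "norm (g z) \<le> 3 ^ N * B" if "norm z = 2" for z
    proof -
      have "norm (1 - z) \<le> 3"
        using norm_triangle_ineq4[of 1 z] that by simp
      moreover have "norm (h (k z) - h 1) \<le> B"
        using close[OF k] that by (simp add: dist_norm less_imp_le)
      ultimately show ?thesis
        unfolding g_def norm_mult norm_power by (intro mult_mono power_mono) auto
    qed
    define v where "v = (1 / of_real (a ^ n) ^ N) *\<^sub>C (comp_op (affine_symbol a) ^^ n) f - u"
    have v: "h2_fun v z = g z" if z: "z \<in> ball 0 1" for z
    proof -
      \<comment> \<open>For \<open>t < 1\<close> the map \<open>k\<close> is the affine symbol with parameter \<open>t\<close>.\<close>
      have in_ball: "norm (k z) < 1"
      proof (cases "t = 1")
        case False
        then show ?thesis
          using affine_symbol_in_ball[of t z] t z by (simp add: k_def affine_symbol_def algebra_simps)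
      qed (use z in \<open>simp add: k_def\<close>)
      have "h2_fun v z = 1 / of_real t ^ N * h2_fun f (k z) - h2_fun u z"
        unfolding v_def k_def t_def minus_hardy2_def plus_hardy2.rep_eq uminus_hardy2.rep_eq
          scaleC_hardy2.rep_eq h2_fun_comp_op_funpow[OF a z] by (rule diff_conv_add_uminus[symmetric])
      also have "\<dots> = 1 / of_real t ^ N * (h (k z) * (1 - k z) ^ N) - h 1 * (1 - z) ^ N"
        using z by (simp only: u f[OF k(1) in_ball] mem_ball_0)
      also have "1 - k z = of_real t * (1 - z)"
        by (simp add: k_def algebra_simps)
      finally show ?thesis
        using t(1) by (simp add: g_def power_mult_distrib) (simp add: algebra_simps)
    qed
    have "norm v \<le> 3 ^ N * B / s"
      unfolding s_def using B by (intro norm_hardy2_le_sup_cball[OF g_hol _ v _ g_bound]) auto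
    also have "\<dots> < eps"
      using eps s by (simp add: B_def)
    finally show "norm (norm ((1 / of_real (a ^ n) ^ N) *\<^sub>C (comp_op (affine_symbol a) ^^ n) f - u) - 0) < eps"
      by (simp add: v_def)
  qed
qed

section \<open>Characterisation of the minimal cyclic subspaces\<close>

theorem corollary5:
  fixes a :: real and f :: hardy2
  assumes "0 < a" and "a < 1"
    and "f \<noteq> 0"
    and "analytic_at_boundary_point f 1"
  shows "minimal_invariant_subspace (comp_op (affine_symbol a))
           (cyclic_subspace (comp_op (affine_symbol a)) f) \<longleftrightarrow>
         (\<exists>(N::nat) (c::complex). \<forall>z \<in> ball 0 1. h2_fun f z = c * (1 - z) ^ N)"
proof -
  let ?T = "comp_op (affine_symbol a)"
  note scale = bounded_linear_comp_op(2)[OF assms(1,2)]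
  show ?thesis
  proof
    assume minimal: "minimal_invariant_subspace ?T (cyclic_subspace ?T f)"
    obtain N h d where h: "0 < d" "h holomorphic_on cball 1 d" "h 1 \<noteq> 0"
      "\<And>w. w \<in> cball 1 d \<Longrightarrow> norm w < 1 \<Longrightarrow> h2_fun f w = h w * (1 - w) ^ N"
      using boundary_point_factorization[OF assms(3,4)] by metis
    obtain u where u: "\<And>z. z \<in> ball 0 1 \<Longrightarrow> h2_fun u z = h 1 * (1 - z) ^ N"
      by (rule hardy2_of_holomorphic_on_cball[of "\<lambda>z. h 1 * (1 - z) ^ N" 2])
        (auto intro!: holomorphic_intros)
    have "u \<in> cyclic_subspace ?T f"
      using rescaled_iterates_tendsto[OF assms(1,2) h(1,2,4) u]
      by (rule scaled_iterate_limit_in_cyclic_subspace)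
    moreover have "u \<noteq> 0"
      using u[of 0] h(3) by (auto simp: zero_hardy2.rep_eq)
    ultimately have "cyclic_subspace ?T f = h2.span {u}"
      using comp_op_affine_eigenvector[OF assms(1,2) u]
      by (intro minimal_invariant_subspace_with_eigenvector[OF minimal scale])
    moreover have "f \<in> cyclic_subspace ?T f"
      by (rule base_in_cyclic_subspace)
    ultimately obtain c where "f = c *\<^sub>C u"
      by (auto simp: h2.span_singleton)
    then have "\<forall>z\<in>ball 0 1. h2_fun f z = (c * h 1) * (1 - z) ^ N"
      using u by (simp add: scaleC_hardy2.rep_eq)
    then show "\<exists>N c. \<forall>z\<in>ball 0 1. h2_fun f z = c * (1 - z) ^ N"
      by blast
  next
    assume "\<exists>N c. \<forall>z\<in>ball 0 1. h2_fun f z = c * (1 - z) ^ N"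
    then obtain N c where "\<And>z. z \<in> ball 0 1 \<Longrightarrow> h2_fun f z = c * (1 - z) ^ N"
      by blast
    then have eigen: "?T f = of_real (a ^ N) *\<^sub>C f"
      by (rule comp_op_affine_eigenvector[OF assms(1,2)])
    show "minimal_invariant_subspace ?T (cyclic_subspace ?T f)"
      unfolding cyclic_subspace_eigenvector[of ?T, OF scale eigen]
      using scale eigen assms(3) by (rule minimal_invariant_subspace_eigenline)
  qed
qed

end
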